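(* Let $n>2$, suppose that $\Lambda_1,\ldots,\Lambda_{n-1}$ are mutually orthogonal Latin squares of order $n$ with pairwise disjoint sets of symbols $\mathcal{L}_1,\ldots,\mathcal{L}_{n-1}$, and let $\bar{S}$ be the $((n+1)\times(n+1))/((n-2)n)$ uniform semi-Latin square constructed from them (as defined in the context). If $n\ge 5$ then $n-2>2$ and $$\eta_{n+1}(\bar{S})=\frac{n(n-2)(n-3)}{2},$$ $$\eta_{n-2}(\bar{S})=\frac{n^2(n-1)(n-2)}{2},$$ $$\eta_{2}(\bar{S})=\frac{n^2(n-2)(n-3)(2n-1)}{2},$$ $$\eta_{1}(\bar{S})=\frac{n(n-1)(n-2)(n^3-4n^2+8n-2)}{2},$$ $$\eta_{0}(\bar{S})=\frac{n^2(n-2)(3n^2-9n+4)}{2},$$ and $\eta_m(\bar{S})=0$ for all other non-negative integers $m$.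
   Context: For integers $m>2$ and $k>0$, an $(m\times m)/k$ semi-Latin square is an $m\times m$ array of $k$-subsets (called blocks) of an $mk$-set (of treatments), such that each treatment occurs once in each row and once in each column of the array. It is uniform if every pair of blocks, not in the same row or column, intersect in the same positive number $\mu$ of treatments. The concurrence of two treatments is the number of blocks (cells) containing both, and $\eta_i(S)$ is the number of unordered pairs of distinct treatments of $S$ with concurrence equal to $i$. Construction of $\bar{S}$. For $i=1,\ldots,n-2$ and $j=1,\ldots,n$, put $\mathcal{L}_{ij}=\{(\alpha,j):\alpha\in\mathcal{L}_i\}$ and $\bar{\mathcal{L}}_i=\mathcal{L}_{i1}\cup\cdots\cup\mathcal{L}_{in}$. Let $\bar{\Lambda}_i$ be the $n$-fold inflation of $\Lambda_i$ using the symbols in $\bar{\mathcal{L}}_i$ (each symbol $\alpha$ is replaced by the $n$ symbols $(\alpha,1),\ldots,(\alpha,n)$). Put $\bar{\mathcal{L}}_{n-1}=\mathcal{L}_{n-1}\times\{1,\ldots,n-2\}$ and let $\bar{\Lambda}_{n-1}$ be the $(n-2)$-fold inflation of $\Lambda_{n-1}$ using the symbols in $\bar{\mathcal{L}}_{n-1}$ (each $\alpha$ is replaced by $(\alpha,1),\ldots,(\alpha,n-2)$). Superpose $\bar{\Lambda}_1,\ldots,\bar{\Lambda}_{n-1}$ (take cellwise unions) to obtain an $(n\times n)/((n-2)(n+1))$ semi-Latin square. Add an extra (initially empty) row and column, numbered $n+1$. For $i,j\in\{1,\ldots,n\}$ and $t=1,\ldots,n-2$, the cell $(i,j)$ contains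 a unique symbol from $\mathcal{L}_{tj}$: remove this symbol from cell $(i,j)$ and insert it in cells $(i,n+1)$ and $(n+1,j)$. Finally put all the symbols in $\bar{\mathcal{L}}_{n-1}$ into cell $(n+1,n+1)$. The resulting $(n+1)\times(n+1)$ array is $\bar{S}$; it is a uniform $((n+1)\times(n+1))/((n-2)n)$ semi-Latin square with $\mu=n-2$. *)

theory Defs
  imports Complex_Main "HOL-Library.Disjoint_Sets"
begin

text \<open>
  Arrays are functions of a row and a column index, both starting from 1. Their values outside
  the stated index range are irrelevant.
\<close>

definition latin_square :: "nat \<Rightarrow> 'a set \<Rightarrow> (nat \<Rightarrow> nat \<Rightarrow> 'a) \<Rightarrow> bool" where
  "latin_square n L \<Lambda> \<longleftrightarrow>
     (\<forall>i\<in>{1..n}. bij_betw (\<lambda>j. \<Lambda> i j) {1..n} L) \<and>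
     (\<forall>j\<in>{1..n}. bij_betw (\<lambda>i. \<Lambda> i j) {1..n} L)"

definition orthogonal_squares ::
  "nat \<Rightarrow> 'a set \<Rightarrow> (nat \<Rightarrow> nat \<Rightarrow> 'a) \<Rightarrow> 'a set \<Rightarrow> (nat \<Rightarrow> nat \<Rightarrow> 'a) \<Rightarrow> bool" where
  "orthogonal_squares n L \<Lambda> L' \<Lambda>' \<longleftrightarrow>
     bij_betw (\<lambda>(i, j). (\<Lambda> i j, \<Lambda>' i j)) ({1..n} \<times> {1..n}) (L \<times> L')"

text \<open>
  The squares \<open>\<Lambda> 1, \<dots>, \<Lambda> r\<close> with symbol sets \<open>L 1, \<dots>, L r\<close>. Disjointness of the symbol sets
  is not part of the notion.
\<close>

definition mols ::
  "nat \<Rightarrow> nat \<Rightarrow> (nat \<Rightarrow> 'a set) \<Rightarrow> (nat \<Rightarrow> nat \<Rightarrow> nat \<Rightarrow> 'a) \<Rightarrow> bool" where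
  "mols r n L \<Lambda> \<longleftrightarrow>
     (\<forall>t\<in>{1..r}. latin_square n (L t) (\<Lambda> t)) \<and>
     (\<forall>s\<in>{1..r}. \<forall>t\<in>{1..r}. s \<noteq> t \<longrightarrow> orthogonal_squares n (L s) (\<Lambda> s) (L t) (\<Lambda> t))"

definition inflation :: "nat \<Rightarrow> (nat \<Rightarrow> nat \<Rightarrow> 'a) \<Rightarrow> nat \<Rightarrow> nat \<Rightarrow> ('a \<times> nat) set" where
  "inflation s \<Lambda> i j = {\<Lambda> i j} \<times> {1..s}"

definition inflation_factor :: "nat \<Rightarrow> nat \<Rightarrow> nat" where
  "inflation_factor n t = (if t = n - 1 then n - 2 else n)"

definition Lbar :: "nat \<Rightarrow> (nat \<Rightarrow> 'a set) \<Rightarrow> nat \<Rightarrow> ('a \<times> nat) set" where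
  "Lbar n L t = L t \<times> {1..inflation_factor n t}"

definition superposition ::
  "nat \<Rightarrow> (nat \<Rightarrow> nat \<Rightarrow> nat \<Rightarrow> 'a) \<Rightarrow> nat \<Rightarrow> nat \<Rightarrow> ('a \<times> nat) set" where
  "superposition n \<Lambda> i j = (\<Union>t\<in>{1..n - 1}. inflation (inflation_factor n t) (\<Lambda> t) i j)"

text \<open>
  The symbols taken out of cell \<open>(i, j)\<close> of the superposition: for each \<open>t \<le> n - 2\<close> the
  unique one lying in \<open>L t \<times> {j}\<close>.
\<close>

definition moved ::
  "nat \<Rightarrow> (nat \<Rightarrow> 'a set) \<Rightarrow> (nat \<Rightarrow> nat \<Rightarrow> nat \<Rightarrow> 'a) \<Rightarrow> nat \<Rightarrow> nat \<Rightarrow> ('a \<times> nat) set" where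
  "moved n L \<Lambda> i j = superposition n \<Lambda> i j \<inter> (\<Union>t\<in>{1..n - 2}. L t \<times> {j})"

definition Sbar ::
  "nat \<Rightarrow> (nat \<Rightarrow> 'a set) \<Rightarrow> (nat \<Rightarrow> nat \<Rightarrow> nat \<Rightarrow> 'a) \<Rightarrow> nat \<Rightarrow> nat \<Rightarrow> ('a \<times> nat) set" where
  "Sbar n L \<Lambda> i j =
     (if i \<in> {1..n} \<and> j \<in> {1..n} then superposition n \<Lambda> i j - moved n L \<Lambda> i j
      else if i \<in> {1..n} \<and> j = n + 1 then (\<Union>j'\<in>{1..n}. moved n L \<Lambda> i j')
      else if i = n + 1 \<and> j \<in> {1..n} then (\<Union>i'\<in>{1..n}. moved n L \<Lambda> i' j)
      else if i = n + 1 \<and> j = n + 1 then Lbar n L (n - 1)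
      else {})"

definition Sbar_treatments :: "nat \<Rightarrow> (nat \<Rightarrow> 'a set) \<Rightarrow> ('a \<times> nat) set" where
  "Sbar_treatments n L = (\<Union>t\<in>{1..n - 1}. Lbar n L t)"

text \<open>Below, \<open>S\<close> is an \<open>m \<times> m\<close> array of subsets of the treatment set \<open>V\<close>.\<close>

definition concurrence :: "nat \<Rightarrow> (nat \<Rightarrow> nat \<Rightarrow> 'b set) \<Rightarrow> 'b \<Rightarrow> 'b \<Rightarrow> nat" where
  "concurrence m S x y = card {(i, j) \<in> {1..m} \<times> {1..m}. x \<in> S i j \<and> y \<in> S i j}"

definition eta :: "'b set \<Rightarrow> nat \<Rightarrow> (nat \<Rightarrow> nat \<Rightarrow> 'b set) \<Rightarrow> nat \<Rightarrow> nat" where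
  "eta V m S c =
     card {{x, y} | x y. x \<in> V \<and> y \<in> V \<and> x \<noteq> y \<and> concurrence m S x y = c}"

end

theory Submission
  imports Defs
begin

text \<open>
  Rows, columns and the symbol classes of the \<open>n - 1\<close> squares are the \<open>n + 1\<close> parallel classes of
  an affine plane on the \<open>n\<^sup>2\<close> cells. Sending \<open>(\<alpha>, j)\<close> to the cell of column \<open>j\<close> containing \<open>\<alpha>\<close>
  identifies the treatments coming from \<open>\<Lambda> t\<close>, \<open>t \<le> n - 2\<close>, with the cells: the treatment of the
  cell \<open>p\<close> occurs on the \<open>t\<close>-line through \<open>p\<close> with \<open>p\<close> itself replaced by the two margin cells in
  the row and the column of \<open>p\<close>. Concurrences are thus decided by which lines join two cells, and
  counting the points on two lines through \<open>p\<close> gives, for each treatment, the number of treatments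
  at each concurrence. Summing over all treatments counts every unordered pair twice.
\<close>

section \<open>Counting by values and by ordered pairs\<close>

text \<open>Turns a case formula for concurrences into the number of cells or treatments at each
  value. Leaving \<open>c\<close> arbitrary means that the vanishing at all other values comes out
  of the same formula.\<close>

lemma card_classify:
  assumes "finite S" "A \<subseteq> S" "B \<subseteq> S" "A \<inter> B = {}" "a \<noteq> b" "a \<noteq> d" "b \<noteq> d"
    and f: "\<And>x. x \<in> S \<Longrightarrow> f x = (if x \<in> A then a else if x \<in> B then b else d)"
  shows "card {x \<in> S. f x = c} =
    (if c = a then card A else if c = b then card B
     else if c = d then card S - card A - card B else 0)"
proof -
  have fin: "finite A" "finite B" using assms(1-3) by (auto intro: finite_subset)
  have iff: "f x = a \<longleftrightarrow> x \<in> A" "f x = b \<longleftrightarrow> x \<in> B" "f x = d \<longleftrightarrow> x \<notin> A \<and> x \<notin> B"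
    if "x \<in> S" for x
    using f[OF that] assms(4-7) by (auto split: if_splits)
  have "{x \<in> S. f x = a} = A" "{x \<in> S. f x = b} = B" "{x \<in> S. f x = d} = S - A - B"
    using iff assms(2,3) by blast+
  moreover have "card (S - A - B) = card S - card A - card B"
    using assms fin by (subst card_Diff_subset) (auto simp: card_Diff_subset)
  moreover have "{x \<in> S. f x = c} = {}" if "c \<noteq> a" "c \<noteq> b" "c \<noteq> d"
    using f that by auto
  ultimately show ?thesis by (metis card.empty)
qed

lemma card_classify2:
  assumes "finite S" "A \<subseteq> S" "a \<noteq> d"
    and f: "\<And>x. x \<in> S \<Longrightarrow> f x = (if x \<in> A then a else d)"
  shows "card {x \<in> S. f x = c} =
    (if c = a then card A else if c = d then card S - card A else 0)"
proof -
  have iff: "f x = a \<longleftrightarrow> x \<in> A" "f x = d \<longleftrightarrow> x \<notin> A" if "x \<in> S" for x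
    using f[OF that] assms(3) by (auto split: if_splits)
  have "{x \<in> S. f x = a} = A" "{x \<in> S. f x = d} = S - A"
    using iff assms(2) by blast+
  moreover have "card (S - A) = card S - card A"
    using assms(1,2) by (simp add: card_Diff_subset finite_subset)
  moreover have "{x \<in> S. f x = c} = {}" if "c \<noteq> a" "c \<noteq> d"
    using f that by auto
  ultimately show ?thesis by (metis card.empty)
qed

text \<open>Double counting: the map from ordered pairs \<open>(x, y)\<close> in \<open>P\<close> to
  \<open>{x, y}\<close> has fibres of size exactly two, because \<open>R\<close> is symmetric and
  \<open>x \<noteq> y\<close>.\<close>

lemma card_symmetric_pairs:
  assumes fin: "finite V" and symm: "\<And>x y. R x y \<Longrightarrow> R y x"
  shows "2 * card {{x, y} | x y. x \<in> V \<and> y \<in> V \<and> x \<noteq> y \<and> R x y} =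
    (\<Sum>x\<in>V. card {y \<in> V - {x}. R x y})"
proof -
  define E where "E = {{x, y} | x y. x \<in> V \<and> y \<in> V \<and> x \<noteq> y \<and> R x y}"
  define P where "P = (SIGMA x:V. {y \<in> V - {x}. R x y})"
  have finE: "finite E" by (rule finite_subset[of _ "Pow V"]) (auto simp: E_def fin)
  have two: "card {z \<in> P. {fst z, snd z} = e} = 2" if "e \<in> E" for e
  proof -
    obtain x y where xy: "e = {x, y}" "x \<in> V" "y \<in> V" "x \<noteq> y" "R x y"
      using \<open>e \<in> E\<close> by (auto simp: E_def)
    then have "{z \<in> P. {fst z, snd z} = e} = {(x, y), (y, x)}"
      using symm by (auto simp: P_def doubleton_eq_iff)
    then show ?thesis using xy by simp
  qed
  have "P = (\<Union>e\<in>E. {z \<in> P. {fst z, snd z} = e})"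
    unfolding P_def E_def by fastforce
  moreover have "card (\<Union>e\<in>E. {z \<in> P. {fst z, snd z} = e}) =
      (\<Sum>e\<in>E. card {z \<in> P. {fst z, snd z} = e})"
    using finE fin by (intro card_UN_disjoint) (auto simp: P_def)
  ultimately have "card P = 2 * card E" using two by simp
  moreover have "card P = (\<Sum>x\<in>V. card {y \<in> V - {x}. R x y})"
    unfolding P_def using fin by (intro card_SigmaI) auto
  ultimately show ?thesis by (simp add: E_def)
qed

text \<open>Phrased as an equality with a singleton because fibres of rows, columns and orthogonal
  pairs become intersections of two lines below.\<close>

lemma bij_betw_fibre_singleton:
  assumes "bij_betw f A B" "b \<in> B"
  shows "\<exists>a. {x \<in> A. f x = b} = {a}"
proof -
  obtain a where "a \<in> A" "f a = b" using assms by (auto simp: bij_betw_def)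
  then have "{x \<in> A. f x = b} = {a}" using assms by (auto simp: bij_betw_def inj_on_def)
  then show ?thesis by blast
qed

section \<open>The affine plane of the squares\<close>

text \<open>The bound \<open>n \<ge> 5\<close> gives \<open>n - 2 > 2\<close>, so the five
  concurrences \<open>n + 1\<close>, \<open>n - 2\<close>, \<open>2\<close>, \<open>1\<close>,
  \<open>0\<close> are pairwise distinct.\<close>

locale mols_array =
  fixes n :: nat and L :: "nat \<Rightarrow> 'a set" and \<Lambda> :: "nat \<Rightarrow> nat \<Rightarrow> nat \<Rightarrow> 'a"
  assumes n_ge: "n \<ge> 5"
    and mols: "mols (n - 1) n L \<Lambda>"
    and disj: "disjoint_family_on L {1..n - 1}"
begin

definition Q :: "(nat \<times> nat) set" where
  "Q = {1..n} \<times> {1..n}"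

definition entry :: "nat \<Rightarrow> nat \<times> nat \<Rightarrow> 'a" where
  "entry t p = \<Lambda> t (fst p) (snd p)"

text \<open>
  Class \<open>0\<close> consists of the rows, class \<open>n\<close> of the columns, and class \<open>t\<close> in between of the symbol
  classes of \<open>\<Lambda> t\<close>.
\<close>

definition line :: "nat \<Rightarrow> nat \<times> nat \<Rightarrow> (nat \<times> nat) set" where
  "line t p = {q \<in> Q. if t = 0 then fst q = fst p
                      else if t = n then snd q = snd p else entry t q = entry t p}"

text \<open>The copy number is the column of \<open>p\<close>; for \<open>t \<le> n - 2\<close> this
  is exactly the symbol of level \<open>t\<close> that the construction takes out of cell
  \<open>p\<close>.\<close>

definition treat :: "nat \<Rightarrow> nat \<times> nat \<Rightarrow> 'a \<times> nat" where
  "treat t p = (entry t p, snd p)"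

definition occ :: "'a \<times> nat \<Rightarrow> (nat \<times> nat) set" where
  "occ x = {(k, l) \<in> {1..n + 1} \<times> {1..n + 1}. x \<in> Sbar n L \<Lambda> k l}"

abbreviation conc :: "'a \<times> nat \<Rightarrow> 'a \<times> nat \<Rightarrow> nat" where
  "conc \<equiv> concurrence (n + 1) (Sbar n L \<Lambda>)"

lemma finite_Q [simp]: "finite Q"
  by (simp add: Q_def)

lemma card_Q: "card Q = n ^ 2"
  by (simp add: Q_def power2_eq_square)

lemma line_subset: "line t p \<subseteq> Q"
  by (auto simp: line_def)

lemma line_bounds: "(k, l) \<in> line t p \<Longrightarrow> k \<in> {1..n} \<and> l \<in> {1..n}"
  using line_subset[of t p] by (auto simp: Q_def)

lemma margin_not_in_line [simp]: "(Suc n, l) \<notin> line t p" "(k, Suc n) \<notin> line t p"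
  using line_bounds[of "Suc n" l t p] line_bounds[of k "Suc n" t p] by auto

lemma finite_line [simp]: "finite (line t p)"
  using finite_subset[OF line_subset] by simp

lemma mem_line_self [simp]: "p \<in> Q \<Longrightarrow> p \<in> line t p"
  by (simp add: line_def)

lemma line_eqI: "q \<in> line t p \<Longrightarrow> line t q = line t p"
  by (auto simp: line_def)

lemma line_sym: "p \<in> Q \<Longrightarrow> q \<in> line t p \<Longrightarrow> p \<in> line t q"
  by (auto simp: line_def)

lemma line_disjoint: "q \<in> Q \<Longrightarrow> q \<notin> line t p \<Longrightarrow> line t p \<inter> line t q = {}"
  using n_ge by (cases "t = 0"; cases "t = n") (simp_all add: line_def disjoint_iff)

lemma latin: "t \<in> {1..n - 1} \<Longrightarrow> latin_square n (L t) (\<Lambda> t)"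
  using mols by (simp add: mols_def)

lemma entry_in: "t \<in> {1..n - 1} \<Longrightarrow> p \<in> Q \<Longrightarrow> entry t p \<in> L t"
  using latin[of t] unfolding latin_square_def entry_def Q_def
  by (metis bij_betwE mem_Times_iff)

text \<open>The affine plane property of nonparallel lines. The Latin property settles a row or
  column against a symbol class, and orthogonality settles two symbol classes.\<close>

lemma lines_meet:
  assumes "s \<le> n" "t \<le> n" "s \<noteq> t" "p \<in> Q" "q \<in> Q"
  shows "\<exists>r. line s p \<inter> line t q = {r}"
proof -
  have rc: "\<exists>r. line 0 p \<inter> line n q = {r}" if "p \<in> Q" "q \<in> Q" for p q
    using that n_ge by (intro exI[of _ "(fst p, snd q)"]) (auto simp: line_def Q_def)
  have rs: "\<exists>r. line 0 p \<inter> line t q = {r}"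
    if "p \<in> Q" "q \<in> Q" and t: "t \<in> {1..n - 1}" for p q t
  proof -
    have "bij_betw (\<lambda>j. \<Lambda> t (fst p) j) {1..n} (L t)"
      using latin[OF t] that(1) by (auto simp: latin_square_def Q_def)
    from bij_betw_fibre_singleton[OF this entry_in[OF t that(2)]] obtain j
      where j: "{x \<in> {1..n}. \<Lambda> t (fst p) x = entry t q} = {j}" by blast
    have "line 0 p \<inter> line t q = {fst p} \<times> {x \<in> {1..n}. \<Lambda> t (fst p) x = entry t q}"
      using that n_ge by (auto simp: line_def Q_def entry_def)
    then show ?thesis unfolding j by auto
  qed
  have cs: "\<exists>r. line n p \<inter> line t q = {r}"
    if "p \<in> Q" "q \<in> Q" and t: "t \<in> {1..n - 1}" for p q t
  proof -
    have "bij_betw (\<lambda>i. \<Lambda> t i (snd p)) {1..n} (L t)"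
      using latin[OF t] that(1) by (auto simp: latin_square_def Q_def)
    from bij_betw_fibre_singleton[OF this entry_in[OF t that(2)]] obtain j
      where j: "{x \<in> {1..n}. \<Lambda> t x (snd p) = entry t q} = {j}" by blast
    have "line n p \<inter> line t q = {x \<in> {1..n}. \<Lambda> t x (snd p) = entry t q} \<times> {snd p}"
      using that n_ge by (auto simp: line_def Q_def entry_def)
    then show ?thesis unfolding j by auto
  qed
  have ss: "\<exists>r. line s p \<inter> line t q = {r}"
    if p: "p \<in> Q" and q: "q \<in> Q" and s: "s \<in> {1..n - 1}" and t: "t \<in> {1..n - 1}" and "s \<noteq> t"
    for p q s t
  proof -
    have "bij_betw (\<lambda>(i, j). (\<Lambda> s i j, \<Lambda> t i j)) Q (L s \<times> L t)"
      using mols that by (auto simp: mols_def orthogonal_squares_def Q_def)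
    then have "bij_betw (\<lambda>r. (entry s r, entry t r)) Q (L s \<times> L t)"
      by (simp add: entry_def case_prod_beta')
    from bij_betw_fibre_singleton[OF this, of "(entry s p, entry t q)"] obtain r
      where "{x \<in> Q. (entry s x, entry t x) = (entry s p, entry t q)} = {r}"
      using entry_in[OF s p] entry_in[OF t q] by blast
    moreover have "line s p \<inter> line t q = {x \<in> Q. (entry s x, entry t x) = (entry s p, entry t q)}"
      using that n_ge by (auto simp: line_def)
    ultimately show ?thesis by auto
  qed
  \<comment> \<open>By symmetry it suffices to take \<open>s < t\<close>; then only \<open>s\<close>
    can be the row class \<open>0\<close> and only \<open>t\<close> can be the column class
    \<open>n\<close>.\<close>
  have less: "\<exists>r. line s p \<inter> line t q = {r}" if "p \<in> Q" "q \<in> Q" "s < t" "t \<le> n" for s t p q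
  proof -
    have "s = 0 \<or> s \<in> {1..n - 1}" "t = n \<or> t \<in> {1..n - 1}" using that by auto
    then consider "s = 0" "t = n" | "s = 0" "t \<in> {1..n - 1}" | "s \<in> {1..n - 1}" "t = n"
      | "s \<in> {1..n - 1}" "t \<in> {1..n - 1}"
      by blast
    then show ?thesis
    proof cases
      case 1
      then show ?thesis using rc[OF that(1,2)] by simp
    next
      case 2
      then show ?thesis using rs[OF that(1,2)] by simp
    next
      case 3
      then show ?thesis using cs[OF that(2,1)] by (simp add: Int_commute[of "line s p"])
    next
      case 4
      then show ?thesis using ss[OF that(1,2)] that by simp
    qed
  qed
  show ?thesis
  proof (cases "s < t")
    case True
    then show ?thesis using less assms by simp
  next
    case False
    then show ?thesis using less[of q p t s] assms by (simp add: Int_commute)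
  qed
qed

lemma lines_through:
  assumes "s \<le> n" "t \<le> n" "s \<noteq> t" "p \<in> Q"
  shows "line s p \<inter> line t p = {p}"
  using lines_meet[OF assms assms(4)] assms(4) by (metis IntI mem_line_self singletonD)

text \<open>A line that is not a row meets each of the \<open>n\<close> rows exactly once, so
  projection to the row index is a bijection.\<close>

lemma card_line:
  assumes "t \<le> n" "p \<in> Q"
  shows "card (line t p) = n"
proof (cases "t = 0")
  case True
  then have "line t p = {fst p} \<times> {1..n}"
    using assms by (auto simp: line_def Q_def)
  then show ?thesis by (simp add: card_cartesian_product)
next
  case False
  have *: "\<exists>r. {q \<in> line t p. fst q = i} = {r}" if "i \<in> {1..n}" for i
  proof -
    \<comment> \<open>Any cell of row \<open>i\<close> would represent that row; the one in column 1
      is chosen.\<close>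
    have "line 0 (i, 1) \<inter> line t p = {q \<in> line t p. fst q = i}"
      by (auto simp: line_def)
    moreover have "(i, 1) \<in> Q" using that by (auto simp: Q_def)
    ultimately show ?thesis using lines_meet[of 0 t "(i,1)" p] assms False by auto
  qed
  have "bij_betw fst (line t p) {1..n}"
    unfolding bij_betw_def
  proof
    show "inj_on fst (line t p)"
    proof (rule inj_onI)
      fix x y assume xy: "x \<in> line t p" "y \<in> line t p" "fst x = fst y"
      then have "fst x \<in> {1..n}" using line_subset[of t p] by (auto simp: Q_def)
      from *[OF this] show "x = y" using xy by (metis (mono_tags, lifting) mem_Collect_eq singletonD)
    qed
    have "fst ` line t p \<subseteq> {1..n}"
      using line_subset[of t p] by (auto simp: Q_def)
    moreover have "i \<in> fst ` line t p" if "i \<in> {1..n}" for i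
      using *[OF that] by force
    ultimately show "fst ` line t p = {1..n}" by blast
  qed
  then show ?thesis by (simp add: bij_betw_same_card)
qed

text \<open>Lines through \<open>p\<close> in different directions share only \<open>p\<close>, so
  each contributes \<open>n - 1\<close> further points and \<open>p\<close> is counted once.\<close>

lemma card_Union_lines:
  assumes D: "D \<subseteq> {0..n}" "D \<noteq> {}" and p: "p \<in> Q"
  shows "card (\<Union>d\<in>D. line d p) = Suc (card D * (n - 1))"
proof -
  have fD: "finite D" by (rule finite_subset[OF D(1)]) simp
  have "(line d p - {p}) \<inter> (line e p - {p}) = {}" if "d \<in> D" "e \<in> D" "d \<noteq> e" for d e
  proof -
    have "line d p \<inter> line e p = {p}" using that D(1) p by (intro lines_through) auto
    then show ?thesis by auto
  qed
  then have "card (\<Union>d\<in>D. line d p - {p}) = (\<Sum>d\<in>D. card (line d p - {p}))"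
    using fD by (intro card_UN_disjoint) auto
  also have "\<dots> = (\<Sum>e\<in>D. n - 1)"
    using D p by (intro sum.cong) (auto simp: card_line)
  finally have "card (\<Union>d\<in>D. line d p - {p}) = card D * (n - 1)" by simp
  then have "card ((\<Union>d\<in>D. line d p) - {p}) = card D * (n - 1)" by simp
  moreover have "p \<in> (\<Union>d\<in>D. line d p)" using D(2) p mem_line_self by blast
  moreover have "finite (\<Union>d\<in>D. line d p)" using fD by simp
  ultimately show ?thesis using card_Suc_Diff1 by metis
qed

section \<open>The cells in which a treatment occurs\<close>

lemma entry_level:
  assumes "t \<in> {1..n - 1}" "s \<in> {1..n - 1}" "p \<in> Q" "a \<in> L t" "entry s p = a"
  shows "s = t"
  using entry_in[of s p] disjoint_family_onD[OF disj, of s t] assms by auto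

lemma mem_superposition:
  assumes "t \<in> {1..n - 1}" "a \<in> L t" "u \<in> {1..inflation_factor n t}" "(k, l) \<in> Q"
  shows "(a, u) \<in> superposition n \<Lambda> k l \<longleftrightarrow> entry t (k, l) = a"
  using assms entry_level[OF assms(1) _ assms(4,2)]
  unfolding superposition_def inflation_def entry_def by force

lemma mem_moved:
  assumes "t \<in> {1..n - 1}" "a \<in> L t" "u \<in> {1..inflation_factor n t}" "(k, l) \<in> Q"
  shows "(a, u) \<in> moved n L \<Lambda> k l \<longleftrightarrow> entry t (k, l) = a \<and> t \<noteq> n - 1 \<and> l = u"
proof -
  \<comment> \<open>By disjointness only the index \<open>t\<close> can contribute to the union
    defining \<open>moved\<close>. That union stops at \<open>n - 2\<close>, so symbols of the last
    square never move.\<close>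
  have "a \<in> L s \<longleftrightarrow> s = t" if "s \<in> {1..n - 1}" for s
    using that assms(1,2) disjoint_family_onD[OF disj that assms(1)] by blast
  then have "(a, u) \<in> (\<Union>s\<in>{1..n - 2}. L s \<times> {l}) \<longleftrightarrow> t \<noteq> n - 1 \<and> u = l"
    using assms(1,2) by (cases "t = n - 1") force+
  then show ?thesis
    using mem_superposition[OF assms] by (auto simp: moved_def)
qed

text \<open>The inflated symbol first fills the whole line. A line of class \<open>t\<close> meets
  column \<open>snd p\<close> only in \<open>p\<close>, so this copy leaves cell \<open>p\<close>
  and no other, and enters one cell of each margin.\<close>

lemma occ_treat:
  assumes t: "t \<in> {1..n - 2}" and p: "p \<in> Q"
  shows "occ (treat t p) = line t p - {p} \<union> {(fst p, n + 1), (n + 1, snd p)}"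
proof -
  have t': "t \<in> {1..n - 1}" "t \<noteq> n - 1" "t \<noteq> n" "t \<noteq> 0" and "t \<le> n"
    using t n_ge by auto
  have u: "snd p \<in> {1..inflation_factor n t}"
    using p t' by (auto simp: inflation_factor_def Q_def)
  have col: "entry t (k, l) = entry t p \<and> l = snd p \<longleftrightarrow> (k, l) = p" if "(k, l) \<in> Q" for k l
  proof
    assume "entry t (k, l) = entry t p \<and> l = snd p"
    then have "(k, l) \<in> line t p \<inter> line n p"
      using that t' n_ge by (auto simp: line_def)
    then show "(k, l) = p" using lines_through[of t n p] t'(3) \<open>t \<le> n\<close> p by simp
  qed auto
  have sup: "treat t p \<in> superposition n \<Lambda> k l \<longleftrightarrow> entry t (k, l) = entry t p"
    if "(k, l) \<in> Q" for k l
    using mem_superposition[OF t'(1) entry_in[OF t'(1) p] u that] by (simp add: treat_def)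
  have mov: "treat t p \<in> moved n L \<Lambda> k l \<longleftrightarrow> (k, l) = p" if "(k, l) \<in> Q" for k l
    using mem_moved[OF t'(1) entry_in[OF t'(1) p] u that] col[OF that] t'
    by (simp add: treat_def)
  \<comment> \<open>The corner cell holds only symbols of the last square, which are disjoint from
    those of level \<open>t\<close>.\<close>
  have last: "treat t p \<notin> Lbar n L (n - 1)"
    using entry_in[OF t'(1) p] disj t' unfolding Lbar_def treat_def disjoint_family_on_def
    by fastforce
  have p': "1 \<le> fst p" "fst p \<le> n" "1 \<le> snd p" "snd p \<le> n" using p by (auto simp: Q_def)
  have "(k, l) \<in> occ (treat t p) \<longleftrightarrow>
      (k, l) \<in> line t p - {p} \<union> {(fst p, n + 1), (n + 1, snd p)}" for k l
  proof -
    \<comment> \<open>The regions of the definition of \<open>Sbar\<close>: interior, extra column,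
      extra row, corner, and everything outside the array.\<close>
    consider "(k, l) \<in> Q" | "k \<in> {1..n}" "l = n + 1" | "k = n + 1" "l \<in> {1..n}"
      | "k = n + 1" "l = n + 1" | "(k, l) \<notin> {1..n + 1} \<times> {1..n + 1}"
      by (auto simp: Q_def le_Suc_eq)
    then show ?thesis
    proof cases
      case 1
      then have "(k, l) \<in> occ (treat t p) \<longleftrightarrow> entry t (k, l) = entry t p \<and> (k, l) \<noteq> p"
        using sup[OF 1] mov[OF 1] by (auto simp: occ_def Sbar_def Q_def)
      then show ?thesis using 1 t' by (auto simp: line_def Q_def)
    next
      case 2
      then have "(k, l) \<in> occ (treat t p) \<longleftrightarrow> (\<exists>j\<in>{1..n}. treat t p \<in> moved n L \<Lambda> k j)"
        by (auto simp: occ_def Sbar_def)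
      also have "\<dots> \<longleftrightarrow> (\<exists>j\<in>{1..n}. (k, j) = p)"
        using 2 mov by (auto simp: Q_def)
      finally show ?thesis using 2 p' line_bounds[of k l t p] by (cases p) auto
    next
      case 3
      then have "(k, l) \<in> occ (treat t p) \<longleftrightarrow> (\<exists>i\<in>{1..n}. treat t p \<in> moved n L \<Lambda> i l)"
        by (auto simp: occ_def Sbar_def)
      also have "\<dots> \<longleftrightarrow> (\<exists>i\<in>{1..n}. (i, l) = p)"
        using 3 mov by (auto simp: Q_def)
      finally show ?thesis using 3 p' line_bounds[of k l t p] by (cases p) auto
    next
      case 4
      then have "(k, l) \<notin> occ (treat t p)" using last by (simp add: occ_def Sbar_def)
      moreover have "(k, l) \<notin> line t p" using 4 line_bounds[of k l t p] by auto
      ultimately show ?thesis using 4 p' by simp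
    next
      case 5
      then have "(k, l) \<notin> occ (treat t p)" by (auto simp: occ_def)
      moreover have "(k, l) \<notin> line t p" using 5 line_bounds[of k l t p] by auto
      ultimately show ?thesis using 5 p' by auto
    qed
  qed
  then show ?thesis by auto
qed

text \<open>Nothing is removed from the last level, so the full line survives and the corner is
  added. Naming the symbol by a cell \<open>p\<close> containing it lets its occurrences be written
  as a line.\<close>

lemma occ_last:
  assumes p: "p \<in> Q" and v: "v \<in> {1..n - 2}"
  shows "occ (entry (n - 1) p, v) = insert (n + 1, n + 1) (line (n - 1) p)"
proof -
  define t where "t = n - 1"
  have t: "t \<in> {1..n - 1}" "t = n - 1" "t \<noteq> n" "t \<noteq> 0" using n_ge by (auto simp: t_def)
  have v': "v \<in> {1..inflation_factor n t}" using v t by (simp add: inflation_factor_def)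
  have sup: "(entry t p, v) \<in> superposition n \<Lambda> k l \<longleftrightarrow> entry t (k, l) = entry t p"
    if "(k, l) \<in> Q" for k l
    using mem_superposition[OF t(1) entry_in[OF t(1) p] v' that] .
  have mov: "(entry t p, v) \<notin> moved n L \<Lambda> k l" if "(k, l) \<in> Q" for k l
    using mem_moved[OF t(1) entry_in[OF t(1) p] v' that] t by simp
  have last: "(entry t p, v) \<in> Lbar n L (n - 1)"
    using entry_in[OF t(1) p] v' t by (simp add: Lbar_def)
  have "(k, l) \<in> occ (entry t p, v) \<longleftrightarrow> (k, l) \<in> insert (n + 1, n + 1) (line t p)" for k l
  proof -
    consider "(k, l) \<in> Q" | "k \<in> {1..n}" "l = n + 1" | "k = n + 1" "l \<in> {1..n}"
      | "k = n + 1" "l = n + 1" | "(k, l) \<notin> {1..n + 1} \<times> {1..n + 1}"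
      by (auto simp: Q_def le_Suc_eq)
    then show ?thesis
    proof cases
      case 1
      then show ?thesis using sup mov t(3,4) p by (auto simp: occ_def Sbar_def line_def Q_def)
    next
      case 2
      then show ?thesis using mov line_bounds[of k l t p] by (auto simp: occ_def Sbar_def Q_def)
    next
      case 3
      then show ?thesis using mov line_bounds[of k l t p] by (auto simp: occ_def Sbar_def Q_def)
    next
      case 4
      then show ?thesis using last by (auto simp: occ_def Sbar_def)
    next
      case 5
      then show ?thesis using line_bounds[of k l t p] by (auto simp: occ_def)
    qed
  qed
  then show ?thesis unfolding t_def by auto
qed

section \<open>Concurrences of two treatments\<close>

lemma conc_occ: "conc x y = card (occ x \<inter> occ y)"
proof -
  have "{(i, j) \<in> {1..n + 1} \<times> {1..n + 1}. x \<in> Sbar n L \<Lambda> i j \<and> y \<in> Sbar n L \<Lambda> i j} = occ x \<inter> occ y"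
    unfolding occ_def by blast
  then show ?thesis by (simp only: concurrence_def)
qed


lemma mem_row: "q \<in> line 0 p \<longleftrightarrow> q \<in> Q \<and> fst q = fst p"
  and mem_col: "q \<in> line n p \<longleftrightarrow> q \<in> Q \<and> snd q = snd p"
  using n_ge by (auto simp: line_def)

lemma mem_last: "q \<in> Q \<Longrightarrow> q \<in> line (n - 1) p \<longleftrightarrow> entry (n - 1) q = entry (n - 1) p"
  using n_ge by (auto simp: line_def)

lemma only_common_line:
  assumes "s \<le> n" "t \<le> n" "s \<noteq> t" "p \<in> Q" "q \<in> line s p" "q \<in> line t p"
  shows "q = p"
  using lines_through[OF assms(1-4)] assms(5,6) by auto

text \<open>The common cells split into interior cells and margin cells: the extra column is shared
  exactly when \<open>p\<close> and \<open>q\<close> lie in one row, the extra row exactly when they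
  lie in one column.\<close>

lemma conc_treat:
  assumes s: "s \<in> {1..n - 2}" and t: "t \<in> {1..n - 2}" and p: "p \<in> Q" and q: "q \<in> Q"
  shows "conc (treat s p) (treat t q) =
    card ((line s p - {p}) \<inter> (line t q - {q})) +
    (if fst p = fst q then 1 else 0) + (if snd p = snd q then 1 else 0)"
proof -
  define R where "R = (if fst p = fst q then {(fst p, n + 1)} else {})"
  define C where "C = (if snd p = snd q then {(n + 1, snd p)} else {})"
  define I where "I = (line s p - {p}) \<inter> (line t q - {q})"
  have pq: "fst p \<le> n" "snd p \<le> n" "fst q \<le> n" "snd q \<le> n" using p q by (auto simp: Q_def)
  have I: "k \<le> n \<and> l \<le> n" if "(k, l) \<in> I" for k l
    using that line_bounds[of k l s p] by (auto simp: I_def)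
  have "occ (treat s p) \<inter> occ (treat t q) = I \<union> (R \<union> C)"
    unfolding occ_treat[OF s p] occ_treat[OF t q] I_def R_def C_def
    using pq by auto
  moreover have "I \<inter> (R \<union> C) = {}" using I by (force simp: R_def C_def split: if_splits)
  moreover have "R \<inter> C = {}" using pq by (auto simp: R_def C_def split: if_splits)
  moreover have "finite I" "finite R" "finite C" by (auto simp: I_def R_def C_def)
  ultimately have "conc (treat s p) (treat t q) = card I + (card R + card C)"
    unfolding conc_occ by (simp add: card_Un_disjoint)
  then show ?thesis by (simp add: I_def R_def C_def)
qed

text \<open>Two lines of one class coincide or are disjoint. If they coincide, \<open>p\<close> and
  \<open>q\<close> are both missing from the \<open>n\<close> common cells and no margin cell is
  shared; if they are disjoint, at most one margin cell is shared because
  \<open>p \<noteq> q\<close>.\<close>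

lemma conc_same_level:
  assumes t: "t \<in> {1..n - 2}" and p: "p \<in> Q" and q: "q \<in> Q" and "p \<noteq> q"
  shows "conc (treat t p) (treat t q) =
    (if q \<in> line t p then n - 2 else if q \<in> line 0 p \<union> line n p then 1 else 0)"
proof (cases "q \<in> line t p")
  case True
  have "t \<le> n" "t \<noteq> 0" "t \<noteq> n" using t n_ge by auto
  then have "q \<notin> line 0 p" "q \<notin> line n p"
    using only_common_line[of t 0 p q] only_common_line[of t n p q] True p \<open>p \<noteq> q\<close> by auto
  moreover have "(line t p - {p}) \<inter> (line t q - {q}) = line t p - {p, q}"
    using line_eqI[OF True] by auto
  moreover have "card (line t p - {p, q}) = n - 2"
    using card_line[OF \<open>t \<le> n\<close> p] p True \<open>p \<noteq> q\<close> by (simp add: card_Diff_subset)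
  ultimately show ?thesis
    using conc_treat[OF t t p q] True q by (simp add: mem_row mem_col)
next
  case False
  have "(line t p - {p}) \<inter> (line t q - {q}) = {}"
    using line_disjoint[OF q False] by auto
  moreover have "\<not> (fst p = fst q \<and> snd p = snd q)" using \<open>p \<noteq> q\<close> by (auto simp: prod_eq_iff)
  ultimately show ?thesis
    using conc_treat[OF t t p q] False q by (auto simp: mem_row mem_col)
qed

text \<open>The two lines meet in one cell \<open>r\<close>, which counts unless it is
  \<open>p\<close> (when \<open>q\<close> is on \<open>line t p\<close>) or \<open>q\<close> (when
  \<open>q\<close> is on \<open>line s p\<close>); shared margin cells are then added.\<close>

lemma conc_diff_level:
  assumes s: "s \<in> {1..n - 2}" and t: "t \<in> {1..n - 2}" and st: "s \<noteq> t"
    and p: "p \<in> Q" and q: "q \<in> Q"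
  shows "conc (treat s p) (treat t q) =
    (if q \<in> line 0 p \<union> line n p then 2 else if q \<in> line s p \<union> line t p then 0 else 1)"
proof -
  have st': "s \<le> n" "t \<le> n" "s \<noteq> 0" "t \<noteq> 0" "s \<noteq> n" "t \<noteq> n" using s t n_ge by auto
  obtain r where r: "line s p \<inter> line t q = {r}"
    using lines_meet[OF st'(1,2) st p q] by blast
  then have I: "(line s p - {p}) \<inter> (line t q - {q}) = {r} - {p, q}" by auto
  have rp: "r = p \<longleftrightarrow> q \<in> line t p"
  proof -
    have "p \<in> line s p \<inter> line t q \<longleftrightarrow> p = r" unfolding r by simp
    then show ?thesis using p q line_sym[of p q t] line_sym[of q p t] by auto
  qed
  have rq: "r = q \<longleftrightarrow> q \<in> line s p"
  proof -
    have "q \<in> line s p \<inter> line t q \<longleftrightarrow> q = r" unfolding r by simp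
    then show ?thesis using q by auto
  qed
  \<comment> \<open>The value 2 has two sources: for \<open>q = p\<close> both margin cells are
    shared and \<open>r\<close> is lost, while for other cells in the row or column \<open>r\<close>
    survives and one margin cell is shared.\<close>
  consider "q = p" | "q \<noteq> p" "q \<in> line 0 p" | "q \<noteq> p" "q \<in> line n p"
    | "q \<notin> line 0 p \<union> line n p" by blast
  then show ?thesis
  proof cases
    case 1
    then show ?thesis using conc_treat[OF s t p q] I rp p by simp
  next
    case 2
    then have "q \<notin> line s p" "q \<notin> line t p" "q \<notin> line n p"
      using only_common_line[of 0 s p q] only_common_line[of 0 t p q] only_common_line[of 0 n p q]
        st' n_ge p by auto
    then have "card ({r} - {p, q}) = 1" using rp rq by simp
    then show ?thesis using conc_treat[OF s t p q] I 2 \<open>q \<notin> line n p\<close> q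
      by (simp add: mem_row mem_col)
  next
    case 3
    then have "q \<notin> line s p" "q \<notin> line t p" "q \<notin> line 0 p"
      using only_common_line[of n s p q] only_common_line[of n t p q] only_common_line[of n 0 p q]
        st' n_ge p by auto
    then have "card ({r} - {p, q}) = 1" using rp rq by simp
    then show ?thesis using conc_treat[OF s t p q] I 3 \<open>q \<notin> line 0 p\<close> q
      by (simp add: mem_row mem_col)
  next
    case 4
    then have "fst p \<noteq> fst q" "snd p \<noteq> snd q" using q by (auto simp: mem_row mem_col)
    moreover have "card ({r} - {p, q}) = (if q \<in> line s p \<union> line t p then 0 else 1)"
      using rp rq by auto
    ultimately show ?thesis using conc_treat[OF s t p q] I 4 by simp
  qed
qed

text \<open>The lines meet in one cell \<open>r\<close>, which is lost exactly when
  \<open>r = p\<close>. The margin cells of \<open>treat t p\<close> avoid the corner, so they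
  contribute nothing.\<close>

lemma conc_last_level:
  assumes t: "t \<in> {1..n - 2}" and p: "p \<in> Q" and q: "q \<in> Q" and v: "v \<in> {1..n - 2}"
  shows "conc (treat t p) (entry (n - 1) q, v) =
    (if entry (n - 1) p = entry (n - 1) q then 0 else 1)"
proof -
  have t': "t \<le> n" "n - 1 \<le> n" "t \<noteq> n - 1" "n - 1 \<noteq> n" "n - 1 \<noteq> 0" using t n_ge by auto
  obtain r where r: "line t p \<inter> line (n - 1) q = {r}"
    using lines_meet[OF t'(1-3) p q] by blast
  have "p \<in> line t p \<inter> line (n - 1) q \<longleftrightarrow> p = r" unfolding r by simp
  then have rp: "r = p \<longleftrightarrow> entry (n - 1) p = entry (n - 1) q"
    using mem_last[OF p] mem_line_self[OF p] by auto
  have "fst p \<le> n" "snd p \<le> n" using p by (auto simp: Q_def)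
  then have "occ (treat t p) \<inter> occ (entry (n - 1) q, v) = {r} - {p}"
    unfolding occ_treat[OF t p] occ_last[OF q v] using r by auto
  moreover have "card ({r} - {p}) = (if r = p then 0 else 1)" by simp
  ultimately show ?thesis unfolding conc_occ rp by simp
qed

text \<open>The corner is always shared; the two lines add \<open>n\<close> cells if they coincide
  and none otherwise.\<close>

lemma conc_last_last:
  assumes p: "p \<in> Q" and q: "q \<in> Q" and v: "v \<in> {1..n - 2}" and w: "w \<in> {1..n - 2}"
  shows "conc (entry (n - 1) p, v) (entry (n - 1) q, w) =
    (if entry (n - 1) q = entry (n - 1) p then n + 1 else 1)"
proof -
  have t': "n - 1 \<le> n" "n - 1 \<noteq> n" "n - 1 \<noteq> 0" using n_ge by auto
  note mem = mem_last[OF q]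
  have eq: "occ (entry (n - 1) p, v) \<inter> occ (entry (n - 1) q, w) =
      insert (n + 1, n + 1) (line (n - 1) p \<inter> line (n - 1) q)"
    unfolding occ_last[OF p v] occ_last[OF q w] by auto
  show ?thesis
  proof (cases "q \<in> line (n - 1) p")
    case True
    then have "card (insert (n + 1, n + 1) (line (n - 1) p \<inter> line (n - 1) q)) = n + 1"
      using line_eqI[OF True] card_line[OF t'(1) p] by simp
    then show ?thesis using eq mem True unfolding conc_occ by simp
  next
    case False
    then show ?thesis using eq mem line_disjoint[OF q False] False unfolding conc_occ by simp
  qed
qed


section \<open>Enumerating the treatments level by level\<close>

lemma inflated_symbols: "t \<in> {1..n - 2} \<Longrightarrow> Lbar n L t = L t \<times> {1..n}"
  and last_symbols: "Lbar n L (n - 1) = L (n - 1) \<times> {1..n - 2}"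
  by (auto simp: Lbar_def inflation_factor_def)

lemma card_symbols:
  assumes "t \<in> {1..n - 1}"
  shows "finite (L t)" "card (L t) = n"
proof -
  have "bij_betw (\<lambda>j. \<Lambda> t 1 j) {1..n} (L t)"
    using latin[OF assms] n_ge by (auto simp: latin_square_def)
  then show "finite (L t)" "card (L t) = n"
    using bij_betw_finite bij_betw_same_card by fastforce+
qed

text \<open>Column \<open>u\<close> of \<open>\<Lambda> t\<close> contains each symbol exactly once,
  so a symbol and its copy number \<open>u\<close> determine a unique cell.\<close>

lemma treat_bij:
  assumes t: "t \<in> {1..n - 2}"
  shows "bij_betw (treat t) Q (Lbar n L t)"
proof -
  have t': "t \<in> {1..n - 1}" "t \<le> n" "t \<noteq> n" "t \<noteq> 0" using t n_ge by auto
  have "inj_on (treat t) Q"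
  proof (rule inj_onI)
    fix p q assume pq: "p \<in> Q" "q \<in> Q" "treat t p = treat t q"
    then have "q \<in> line t p" "q \<in> line n p"
      using t' n_ge by (auto simp: treat_def line_def)
    then show "p = q" using only_common_line[of t n p q] t' pq(1) by auto
  qed
  moreover have "treat t ` Q \<subseteq> Lbar n L t"
  proof
    fix x assume "x \<in> treat t ` Q"
    then obtain p where p: "p \<in> Q" "x = treat t p" by blast
    then show "x \<in> Lbar n L t"
      using entry_in[OF t'(1) p(1)] by (auto simp: inflated_symbols[OF t] treat_def Q_def)
  qed
  moreover have "x \<in> treat t ` Q" if x: "x \<in> Lbar n L t" for x
  proof -
    obtain a u where a: "x = (a, u)" "a \<in> L t" "u \<in> {1..n}"
      using x inflated_symbols[OF t] by auto
    have "bij_betw (\<lambda>i. \<Lambda> t i u) {1..n} (L t)"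
      using latin[OF t'(1)] a by (auto simp: latin_square_def)
    then obtain i where "i \<in> {1..n}" "\<Lambda> t i u = a"
      using a(2) by (metis bij_betw_imp_surj_on imageE)
    then have "x = treat t (i, u)" "(i, u) \<in> Q"
      using a by (auto simp: treat_def entry_def Q_def)
    then show ?thesis by blast
  qed
  ultimately show ?thesis unfolding bij_betw_def by blast
qed

text \<open>Column 1 of the last square already contains every symbol, so each treatment of this
  level has the form required by \<open>occ_last\<close>.\<close>

lemma last_symbolE:
  assumes "x \<in> Lbar n L (n - 1)"
  obtains p v where "p \<in> Q" "v \<in> {1..n - 2}" "x = (entry (n - 1) p, v)"
proof -
  obtain b v where x: "x = (b, v)" "b \<in> L (n - 1)" "v \<in> {1..n - 2}"
    using assms unfolding last_symbols by blast
  have "bij_betw (\<lambda>i. \<Lambda> (n - 1) i 1) {1..n} (L (n - 1))"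
    using latin[of "n - 1"] n_ge by (auto simp: latin_square_def)
  then have "b \<in> (\<lambda>i. \<Lambda> (n - 1) i 1) ` {1..n}"
    using x(2) by (simp only: bij_betw_imp_surj_on)
  then obtain i where "i \<in> {1..n}" "\<Lambda> (n - 1) i 1 = b" by blast
  then have "(i, 1) \<in> Q" "entry (n - 1) (i, 1) = b" by (auto simp: entry_def Q_def)
  then show thesis using that x(1,3) by blast
qed

lemma finite_Lbar: "t \<in> {1..n - 1} \<Longrightarrow> finite (Lbar n L t)"
  using card_symbols(1)[of t] by (simp add: Lbar_def)

lemma finite_treatments: "finite (Sbar_treatments n L)"
  using finite_Lbar by (simp add: Sbar_treatments_def)

text \<open>Levels up to \<open>n - 2\<close> are summed over cells through \<open>treat\<close>.
  The last level has only \<open>n - 2\<close> copies of each symbol and stays a separate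
  sum.\<close>

lemma sum_treatments:
  fixes g :: "'a \<times> nat \<Rightarrow> nat"
  shows "sum g (Sbar_treatments n L) =
    (\<Sum>t\<in>{1..n - 2}. \<Sum>q\<in>Q. g (treat t q)) + sum g (Lbar n L (n - 1))"
proof -
  have "sum g (Sbar_treatments n L) = (\<Sum>t\<in>{1..n - 1}. sum g (Lbar n L t))"
    unfolding Sbar_treatments_def
  proof (rule sum.UNION_disjoint)
    show "\<forall>s\<in>{1..n - 1}. \<forall>t\<in>{1..n - 1}. s \<noteq> t \<longrightarrow> Lbar n L s \<inter> Lbar n L t = {}"
    proof (intro ballI impI)
      fix s t assume "s \<in> {1..n - 1}" "t \<in> {1..n - 1}" "s \<noteq> t"
      then show "Lbar n L s \<inter> Lbar n L t = {}"
        using disjoint_family_onD[OF disj] by (auto simp: Lbar_def)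
    qed
  qed (use finite_Lbar in auto)
  also have "{1..n - 1} = insert (n - 1) {1..n - 2}" using n_ge by auto
  also have "(\<Sum>t\<in>insert (n - 1) {1..n - 2}. sum g (Lbar n L t)) =
      sum g (Lbar n L (n - 1)) + (\<Sum>t\<in>{1..n - 2}. sum g (Lbar n L t))"
    using n_ge by (subst sum.insert) auto
  also have "(\<Sum>t\<in>{1..n - 2}. sum g (Lbar n L t)) = (\<Sum>t\<in>{1..n - 2}. \<Sum>q\<in>Q. g (treat t q))"
    using sum.reindex_bij_betw[OF treat_bij, of _ g] by (intro sum.cong) auto
  finally show ?thesis by simp
qed

lemma card_treatments:
  "card {y \<in> Sbar_treatments n L. P y} =
    (\<Sum>t\<in>{1..n - 2}. card {q \<in> Q. P (treat t q)}) + card {y \<in> Lbar n L (n - 1). P y}"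
proof -
  have card_sum: "card {x \<in> S. R x} = (\<Sum>x\<in>S. of_bool (R x))" if "finite S"
    for S :: "'b set" and R
    using that by (simp add: Collect_conj_eq)
  have "finite (Lbar n L (n - 1))" using finite_Lbar n_ge by simp
  then show ?thesis
    using sum_treatments[of "\<lambda>y. of_bool (P y)"] by (simp only: card_sum finite_Q finite_treatments)
qed

section \<open>Counting partners at each concurrence within one level\<close>

lemma count_same_level:
  assumes t: "t \<in> {1..n - 2}" and p: "p \<in> Q"
  shows "card {q \<in> Q. treat t q \<noteq> treat t p \<and> conc (treat t p) (treat t q) = c} =
    (if c = n - 2 then n - 1 else if c = 1 then 2 * (n - 1)
     else if c = 0 then (n - 1) * (n - 2) else 0)"
proof -
  have t': "t \<le> n" "t \<noteq> 0" "t \<noteq> n" using t n_ge by auto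
  have cQ: "card (Q - {p}) = n ^ 2 - 1" using p by (simp add: card_Q)
  have eq: "{q \<in> Q. treat t q \<noteq> treat t p \<and> conc (treat t p) (treat t q) = c} =
      {q \<in> Q - {p}. conc (treat t p) (treat t q) = c}"
    using treat_bij[OF t] p by (auto simp: bij_betw_def inj_on_def)
  have A: "card (line t p - {p}) = n - 1"
    using card_line[OF t'(1) p] p by simp
  have "card (\<Union>d\<in>{0, n}. line d p) = Suc (2 * (n - 1))"
    using card_Union_lines[of "{0, n}" p] p n_ge by simp
  then have B: "card ((line 0 p \<union> line n p) - {p}) = 2 * (n - 1)"
    using p by simp
  have dj: "(line t p - {p}) \<inter> ((line 0 p \<union> line n p) - {p}) = {}"
    using only_common_line[of t 0 p] only_common_line[of t n p] t' p by blast
  have sub: "line t p - {p} \<subseteq> Q - {p}" "line 0 p \<union> line n p - {p} \<subseteq> Q - {p}"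
    using line_subset[of t p] line_subset[of 0 p] line_subset[of n p] by blast+
  have "card {q \<in> Q - {p}. conc (treat t p) (treat t q) = c} =
    (if c = n - 2 then card (line t p - {p})
     else if c = 1 then card ((line 0 p \<union> line n p) - {p})
     else if c = 0 then card (Q - {p}) - card (line t p - {p}) - card ((line 0 p \<union> line n p) - {p})
     else 0)"
    using n_ge dj sub conc_same_level[OF t p] by (intro card_classify) auto
  moreover have "n ^ 2 - 1 - (n - 1) - 2 * (n - 1) = (n - 1) * (n - 2)"
  proof -
    \<comment> \<open>This substitution turns the truncated subtractions into polynomial arithmetic
      over \<open>m\<close>.\<close>
    obtain m where "n = m + 5" using n_ge le_Suc_ex by (metis add.commute)
    then show ?thesis by (simp add: power2_eq_square algebra_simps)
  qed
  ultimately show ?thesis unfolding eq A B cQ by (simp only:)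
qed

lemma count_diff_level:
  assumes s: "s \<in> {1..n - 2}" and t: "t \<in> {1..n - 2}" and st: "s \<noteq> t" and p: "p \<in> Q"
  shows "card {q \<in> Q. treat t q \<noteq> treat s p \<and> conc (treat s p) (treat t q) = c} =
    (if c = 2 then 2 * n - 1 else if c = 0 then 2 * (n - 1)
     else if c = 1 then (n - 1) * (n - 3) else 0)"
proof -
  have st': "s \<in> {1..n - 1}" "t \<in> {1..n - 1}" "s \<le> n" "t \<le> n" "s \<noteq> 0" "t \<noteq> 0" "s \<noteq> n" "t \<noteq> n"
    using s t n_ge by auto
  have "treat t q \<noteq> treat s p" if "q \<in> Q" for q
    using disjoint_family_onD[OF disj st'(1,2) st] entry_in[OF st'(1) p] entry_in[OF st'(2) that]
    by (auto simp: treat_def)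
  then have eq: "{q \<in> Q. treat t q \<noteq> treat s p \<and> conc (treat s p) (treat t q) = c} =
      {q \<in> Q. conc (treat s p) (treat t q) = c}"
    by auto
  have "card (\<Union>d\<in>{0, n}. line d p) = Suc (2 * (n - 1))"
    using card_Union_lines[of "{0, n}" p] p n_ge by simp
  then have A: "card (line 0 p \<union> line n p) = 2 * n - 1" using n_ge by simp
  have "card (\<Union>d\<in>{s, t}. line d p) = Suc (2 * (n - 1))"
    using card_Union_lines[of "{s, t}" p] p st st' by simp
  then have B: "card ((line s p \<union> line t p) - {p}) = 2 * (n - 1)" using p by simp
  \<comment> \<open>The cell \<open>p\<close> lies on all four lines but yields concurrence 2, so it
    is kept in the first set, of size \<open>2 * n - 1\<close>, and removed from the second.\<close>
  have dj: "(line 0 p \<union> line n p) \<inter> ((line s p \<union> line t p) - {p}) = {}"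
    using only_common_line[of 0 s p] only_common_line[of n s p]
      only_common_line[of 0 t p] only_common_line[of n t p] st' p by blast
  have sub: "line 0 p \<union> line n p \<subseteq> Q" "line s p \<union> line t p - {p} \<subseteq> Q"
    using line_subset[of t p] line_subset[of s p] line_subset[of 0 p] line_subset[of n p] by blast+
  have "card {q \<in> Q. conc (treat s p) (treat t q) = c} =
    (if c = 2 then card (line 0 p \<union> line n p)
     else if c = 0 then card ((line s p \<union> line t p) - {p})
     else if c = 1 then card Q - card (line 0 p \<union> line n p) - card ((line s p \<union> line t p) - {p})
     else 0)"
    using dj sub conc_diff_level[OF s t st p] by (intro card_classify) auto
  moreover have "n ^ 2 - (2 * n - 1) - 2 * (n - 1) = (n - 1) * (n - 3)"
  proof -
    obtain m where "n = m + 5" using n_ge le_Suc_ex by (metis add.commute)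
    then show ?thesis by (simp add: power2_eq_square algebra_simps)
  qed
  ultimately show ?thesis unfolding eq A B card_Q by (simp only:)
qed

lemma card_last: "finite (Lbar n L (n - 1))" "card (Lbar n L (n - 1)) = n * (n - 2)"
  using card_symbols[of "n - 1"] n_ge by (auto simp: last_symbols[simplified] card_cartesian_product)

lemma count_last_level:
  assumes t: "t \<in> {1..n - 2}" and p: "p \<in> Q"
  shows "card {y \<in> Lbar n L (n - 1). y \<noteq> treat t p \<and> conc (treat t p) y = c} =
    (if c = 0 then n - 2 else if c = 1 then (n - 1) * (n - 2) else 0)"
proof -
  have t': "t \<in> {1..n - 1}" "n - 1 \<in> {1..n - 1}" "t \<noteq> n - 1" using t n_ge by auto
  \<comment> \<open>The copies of the last-square symbol in cell \<open>p\<close>: exactly the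
    treatments of this level that never meet \<open>treat t p\<close>.\<close>
  define A where "A = {entry (n - 1) p} \<times> {1..n - 2}"
  have A: "A \<subseteq> Lbar n L (n - 1)" using entry_in[OF t'(2) p] by (auto simp: A_def last_symbols[simplified])
  have "treat t p \<notin> Lbar n L (n - 1)"
    using disjoint_family_onD[OF disj t'] entry_in[OF t'(1) p]
    by (auto simp: treat_def last_symbols[simplified])
  then have eq: "{y \<in> Lbar n L (n - 1). y \<noteq> treat t p \<and> conc (treat t p) y = c} =
      {y \<in> Lbar n L (n - 1). conc (treat t p) y = c}"
    by auto
  have val: "conc (treat t p) y = (if y \<in> A then 0 else 1)" if mem: "y \<in> Lbar n L (n - 1)" for y
  proof -
    obtain q v where y: "q \<in> Q" "v \<in> {1..n - 2}" "y = (entry (n - 1) q, v)"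
      using mem by (rule last_symbolE)
    show ?thesis using conc_last_level[OF t p y(1,2)] y by (auto simp: A_def)
  qed
  have "card {y \<in> Lbar n L (n - 1). conc (treat t p) y = c} =
      (if c = 0 then card A else if c = 1 then card (Lbar n L (n - 1)) - card A else 0)"
    using card_last A val by (intro card_classify2) auto
  moreover have "card A = n - 2" by (simp add: A_def)
  moreover have "n * (n - 2) - (n - 2) = (n - 1) * (n - 2)" by (simp add: diff_mult_distrib)
  ultimately show ?thesis unfolding eq card_last by (simp only:)
qed

lemma conc_commute: "conc x y = conc y x"
  unfolding conc_occ by (simp add: Int_commute)

text \<open>The counterpart of \<open>count_last_level\<close> from the other side: concurrence 0
  occurs for the \<open>n\<close> cells on the line of the symbol.\<close>

lemma count_level_from_last:
  assumes t: "t \<in> {1..n - 2}" and p: "p \<in> Q" and v: "v \<in> {1..n - 2}"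
  defines "x \<equiv> (entry (n - 1) p, v)"
  shows "card {q \<in> Q. treat t q \<noteq> x \<and> conc x (treat t q) = c} =
    (if c = 0 then n else if c = 1 then n * (n - 1) else 0)"
proof -
  have t': "t \<in> {1..n - 1}" "n - 1 \<in> {1..n - 1}" "t \<noteq> n - 1" "n - 1 \<le> n" using t n_ge by auto
  have "treat t q \<noteq> x" if "q \<in> Q" for q
    using disjoint_family_onD[OF disj t'(1-3)] entry_in[OF t'(1) that] entry_in[OF t'(2) p]
    by (auto simp: treat_def x_def)
  then have eq: "{q \<in> Q. treat t q \<noteq> x \<and> conc x (treat t q) = c} =
      {q \<in> Q. conc x (treat t q) = c}"
    by auto
  have val: "conc x (treat t q) = (if q \<in> line (n - 1) p then 0 else 1)" if "q \<in> Q" for q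
    using conc_last_level[OF t that p v] mem_last[OF that, of p] conc_commute[of x "treat t q"]
    unfolding x_def by simp
  have "card {q \<in> Q. conc x (treat t q) = c} =
      (if c = 0 then card (line (n - 1) p) else if c = 1 then card Q - card (line (n - 1) p) else 0)"
    using line_subset val by (intro card_classify2) auto
  moreover have "n ^ 2 - n = n * (n - 1)" by (simp add: power2_eq_square diff_mult_distrib2)
  ultimately show ?thesis unfolding eq card_line[OF t'(4) p] card_Q by (simp only:)
qed

lemma count_last_from_last:
  assumes p: "p \<in> Q" and v: "v \<in> {1..n - 2}"
  defines "x \<equiv> (entry (n - 1) p, v)"
  shows "card {y \<in> Lbar n L (n - 1). y \<noteq> x \<and> conc x y = c} =
    (if c = n + 1 then n - 3 else if c = 1 then (n - 1) * (n - 2) else 0)"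
proof -
  \<comment> \<open>The \<open>n - 3\<close> other copies of the same symbol, which occur in the
    same \<open>n + 1\<close> cells as \<open>x\<close>.\<close>
  define A where "A = {entry (n - 1) p} \<times> ({1..n - 2} - {v})"
  have b: "entry (n - 1) p \<in> L (n - 1)" using entry_in[of "n - 1" p] p n_ge by auto
  have x: "x \<in> Lbar n L (n - 1)" using b v by (simp add: x_def last_symbols[simplified])
  have A: "A \<subseteq> Lbar n L (n - 1) - {x}" using b by (auto simp: A_def x_def last_symbols[simplified])
  have eq: "{y \<in> Lbar n L (n - 1). y \<noteq> x \<and> conc x y = c} =
      {y \<in> Lbar n L (n - 1) - {x}. conc x y = c}"
    by auto
  have val: "conc x y = (if y \<in> A then n + 1 else 1)" if mem: "y \<in> Lbar n L (n - 1) - {x}" for y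
  proof -
    obtain q w where y: "q \<in> Q" "w \<in> {1..n - 2}" "y = (entry (n - 1) q, w)"
      using mem last_symbolE by blast
    show ?thesis using conc_last_last[OF p y(1) v y(2)] y that by (auto simp: A_def x_def)
  qed
  have "card {y \<in> Lbar n L (n - 1) - {x}. conc x y = c} =
      (if c = n + 1 then card A else if c = 1 then card (Lbar n L (n - 1) - {x}) - card A else 0)"
    using card_last A val n_ge by (intro card_classify2) auto
  moreover have "card A = n - 3" using v by (simp add: A_def)
  moreover have "card (Lbar n L (n - 1) - {x}) = n * (n - 2) - 1" using x card_last by simp
  moreover have "n * (n - 2) - 1 - (n - 3) = (n - 1) * (n - 2)"
  proof -
    obtain m where "n = m + 5" using n_ge le_Suc_ex by (metis add.commute)
    then show ?thesis by (simp add: algebra_simps)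
  qed
  ultimately show ?thesis unfolding eq by (simp only:)
qed

section \<open>Degrees of treatments and the final sum\<close>

text \<open>Where three summands occur, they come from the treatment's own level, the
  \<open>n - 3\<close> other inflated levels, and the last level, in this order.\<close>

definition deg_treat :: "nat \<Rightarrow> nat" where
  "deg_treat c = (if c = n - 2 then n - 1 else if c = 2 then (n - 3) * (2 * n - 1)
    else if c = 1 then 2 * (n - 1) + (n - 3) * ((n - 1) * (n - 3)) + (n - 1) * (n - 2)
    else if c = 0 then (n - 1) * (n - 2) + (n - 3) * (2 * (n - 1)) + (n - 2) else 0)"

text \<open>The factor \<open>n - 2\<close> counts the inflated levels; the terms without an
  inflated contribution, \<open>n - 3\<close> and \<open>(n - 1) * (n - 2)\<close>, come from the
  last level itself.\<close>

definition deg_last :: "nat \<Rightarrow> nat" where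
  "deg_last c = (if c = n + 1 then n - 3
    else if c = 1 then (n - 2) * (n * (n - 1)) + (n - 1) * (n - 2)
    else if c = 0 then (n - 2) * n else 0)"

lemma degree_treat:
  assumes t: "t \<in> {1..n - 2}" and p: "p \<in> Q"
  shows "card {y \<in> Sbar_treatments n L - {treat t p}. conc (treat t p) y = c} = deg_treat c"
proof -
  have eq: "{y \<in> Sbar_treatments n L - {treat t p}. conc (treat t p) y = c} =
      {y \<in> Sbar_treatments n L. y \<noteq> treat t p \<and> conc (treat t p) y = c}" by auto
  let ?f = "\<lambda>s. card {q \<in> Q. treat s q \<noteq> treat t p \<and> conc (treat t p) (treat s q) = c}"
  have c3: "card ({1..n - 2} - {t}) = n - 3" using t by simp
  \<comment> \<open>The treatment's own level follows a different formula and is split off; the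
    other levels all give the same count.\<close>
  have "(\<Sum>s\<in>{1..n - 2}. ?f s) = ?f t + (\<Sum>s\<in>{1..n - 2} - {t}. ?f s)"
    using t by (subst sum.remove[of _ t]) auto
  also have "(\<Sum>s\<in>{1..n - 2} - {t}. ?f s) = (\<Sum>s\<in>{1..n - 2} - {t}. if c = 2 then 2 * n - 1
      else if c = 0 then 2 * (n - 1) else if c = 1 then (n - 1) * (n - 3) else 0)"
  proof (rule sum.cong)
    fix s assume "s \<in> {1..n - 2} - {t}"
    then show "?f s = (if c = 2 then 2 * n - 1
      else if c = 0 then 2 * (n - 1) else if c = 1 then (n - 1) * (n - 3) else 0)"
      using count_diff_level[OF t _ _ p, of s c] by auto
  qed simp
  finally have "(\<Sum>s\<in>{1..n - 2}. ?f s) = ?f t + (\<Sum>s\<in>{1..n - 2} - {t}. if c = 2 then 2 * n - 1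
      else if c = 0 then 2 * (n - 1) else if c = 1 then (n - 1) * (n - 3) else 0)" .
  moreover have "n - 2 \<noteq> 0" "n - 2 \<noteq> 1" "n - 2 \<noteq> 2" using n_ge by auto
  ultimately show ?thesis
    unfolding eq card_treatments count_last_level[OF t p] count_same_level[OF t p] deg_treat_def
      sum_constant c3
    by auto
qed

lemma degree_last:
  assumes "x \<in> Lbar n L (n - 1)"
  shows "card {y \<in> Sbar_treatments n L - {x}. conc x y = c} = deg_last c"
proof -
  obtain p v where x: "p \<in> Q" "v \<in> {1..n - 2}" "x = (entry (n - 1) p, v)"
    using assms by (rule last_symbolE)
  have eq: "{y \<in> Sbar_treatments n L - {x}. conc x y = c} =
      {y \<in> Sbar_treatments n L. y \<noteq> x \<and> conc x y = c}" by auto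
  have "(\<Sum>s\<in>{1..n - 2}. card {q \<in> Q. treat s q \<noteq> x \<and> conc x (treat s q) = c}) =
      (\<Sum>s\<in>{1..n - 2}. if c = 0 then n else if c = 1 then n * (n - 1) else 0)"
    using count_level_from_last[OF _ x(1,2), of _ c] x(3) by (intro sum.cong) auto
  moreover have "card {y \<in> Lbar n L (n - 1). y \<noteq> x \<and> conc x y = c} =
      (if c = n + 1 then n - 3 else if c = 1 then (n - 1) * (n - 2) else 0)"
    using count_last_from_last[OF x(1,2), of c] x(3) by simp
  ultimately show ?thesis
    unfolding eq card_treatments deg_last_def using n_ge by simp
qed

text \<open>The degree takes one value on the \<open>(n - 2) * n ^ 2\<close> treatments from
  inflated levels and another on the \<open>n * (n - 2)\<close> from the last. Keeping the factor 2
  avoids division in the naturals.\<close>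

lemma eta_double:
  "2 * eta (Sbar_treatments n L) (n + 1) (Sbar n L \<Lambda>) c =
    (n - 2) * (n ^ 2 * deg_treat c) + n * (n - 2) * deg_last c"
proof -
  let ?V = "Sbar_treatments n L"
  define g where "g x = card {y \<in> ?V - {x}. conc x y = c}" for x
  have "2 * eta ?V (n + 1) (Sbar n L \<Lambda>) c = (\<Sum>x\<in>?V. g x)"
    unfolding eta_def g_def using finite_treatments conc_commute
    by (intro card_symmetric_pairs) auto
  also have "\<dots> = (\<Sum>t\<in>{1..n - 2}. \<Sum>q\<in>Q. deg_treat c) + (\<Sum>x\<in>Lbar n L (n - 1). deg_last c)"
    unfolding sum_treatments g_def using degree_treat degree_last by simp
  also have "\<dots> = (n - 2) * (n ^ 2 * deg_treat c) + n * (n - 2) * deg_last c"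
    by (simp add: card_Q card_last(2)[simplified])
  finally show ?thesis .
qed

end

theorem theorem7:
  fixes n :: nat and L :: "nat \<Rightarrow> 'a set" and \<Lambda> :: "nat \<Rightarrow> nat \<Rightarrow> nat \<Rightarrow> 'a"
  assumes "n > 2"
    and "mols (n - 1) n L \<Lambda>"
    and "disjoint_family_on L {1..n - 1}"
  defines "\<eta> \<equiv> eta (Sbar_treatments n L) (n + 1) (Sbar n L \<Lambda>)"
  shows "n \<ge> 5 \<longrightarrow>
    n - 2 > 2 \<and>
    real (\<eta> (n + 1)) = real n * (real n - 2) * (real n - 3) / 2 \<and>
    real (\<eta> (n - 2)) = real n ^ 2 * (real n - 1) * (real n - 2) / 2 \<and>
    real (\<eta> 2) = real n ^ 2 * (real n - 2) * (real n - 3) * (2 * real n - 1) / 2 \<and>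
    real (\<eta> 1) = real n * (real n - 1) * (real n - 2)
                   * (real n ^ 3 - 4 * real n ^ 2 + 8 * real n - 2) / 2 \<and>
    real (\<eta> 0) = real n ^ 2 * (real n - 2) * (3 * real n ^ 2 - 9 * real n + 4) / 2 \<and>
    (\<forall>m. m \<notin> {n + 1, n - 2, 2, 1, 0} \<longrightarrow> \<eta> m = 0)"
proof
  assume n: "n \<ge> 5"
  interpret mols_array n L \<Lambda> using n assms(2,3) by unfold_locales
  have eta: "2 * \<eta> c = (n - 2) * (n ^ 2 * deg_treat c) + n * (n - 2) * deg_last c" for c
    unfolding \<eta>_def by (rule eta_double)
  \<comment> \<open>The bound on \<open>k\<close> with \<open>n \<ge> 5\<close> excludes
    truncation.\<close>
  have sub: "real (n - k) = real n - real k" if "k \<le> 5" for k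
    using n that by (simp add: of_nat_diff)
  have half: "real (\<eta> c) = x / 2"
    if "real ((n - 2) * (n ^ 2 * deg_treat c) + n * (n - 2) * deg_last c) = x" for c x
    using that unfolding eta[symmetric] by simp
  have deg: "deg_treat (n + 1) = 0" "deg_last (n + 1) = n - 3" "deg_treat (n - 2) = n - 1" "deg_last (n - 2) = 0"
    "deg_treat 2 = (n - 3) * (2 * n - 1)" "deg_last 2 = 0"
    "deg_treat 1 = 2 * (n - 1) + (n - 3) * ((n - 1) * (n - 3)) + (n - 1) * (n - 2)"
    "deg_last 1 = (n - 2) * (n * (n - 1)) + (n - 1) * (n - 2)"
    "deg_treat 0 = (n - 1) * (n - 2) + (n - 3) * (2 * (n - 1)) + (n - 2)"
    "deg_last 0 = (n - 2) * n"
    using n by (auto simp: deg_treat_def deg_last_def)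
  have sub2: "real (2 * n - 1) = 2 * real n - 1" using n by (simp add: of_nat_diff)
  show "n - 2 > 2 \<and>
    real (\<eta> (n + 1)) = real n * (real n - 2) * (real n - 3) / 2 \<and>
    real (\<eta> (n - 2)) = real n ^ 2 * (real n - 1) * (real n - 2) / 2 \<and>
    real (\<eta> 2) = real n ^ 2 * (real n - 2) * (real n - 3) * (2 * real n - 1) / 2 \<and>
    real (\<eta> 1) = real n * (real n - 1) * (real n - 2)
                   * (real n ^ 3 - 4 * real n ^ 2 + 8 * real n - 2) / 2 \<and>
    real (\<eta> 0) = real n ^ 2 * (real n - 2) * (3 * real n ^ 2 - 9 * real n + 4) / 2 \<and>
    (\<forall>m. m \<notin> {n + 1, n - 2, 2, 1, 0} \<longrightarrow> \<eta> m = 0)"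
  proof (intro conjI allI impI)
    show "n - 2 > 2" using n by simp
    show "\<eta> m = 0" if "m \<notin> {n + 1, n - 2, 2, 1, 0}" for m
      \<comment> \<open>Outside the five values both degrees fall to their default 0.\<close>
      using eta[of m] that by (simp add: deg_treat_def deg_last_def)
  \<comment> \<open>The five remaining goals are polynomial identities over the reals once the
    degrees are inserted.\<close>
  qed (rule half; simp only: deg of_nat_add of_nat_mult of_nat_power sub sub2;
      simp add: algebra_simps power2_eq_square power3_eq_cube)+
qed

end
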